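(* There exists a simple countable directed acyclic graph $G$ that is not majority $2$-colorable; that is, for every map $\phi : V(G) \to \{1,2\}$ there is a vertex $v \in V(G)$ with $$\#\{vu \in E(G) : \phi(u) \neq \phi(v)\} < \#\{vu \in E(G) : \phi(u) = \phi(v)\}.$$
   Context: A simple directed graph $G=(V,E)$ has no loops and no multiple edges; an edge $vu \in E(G)$ is directed from $v$ to $u$ (an out-edge of $v$). $G$ is acyclic if it has no directed cycle. A vertex coloring $\phi : V(G) \to \mathbb{N}$ is a majority coloring if for every vertex $v \in V(G)$ $$\#\{vu \in E(G) : \phi(u) \neq \phi(v)\} \geqslant \#\{vu \in E(G) : \phi(u) = \phi(v)\},$$ where $\#$ denotes cardinality (possibly infinite, compared as cardinals); i.e. at most half of the out-edges of each vertex are monochromatic. A digraph is majority $k$-colorable if it admits a majority coloring using at most $k$ colors. Out-degrees may be infinite. *)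

theory Defs
  imports
    "HOL-Library.Countable_Set"
    "HOL-Library.Equipollence"
    "HOL-Library.FuncSet"
    "Graph_Theory.Digraph"
    "Graph_Theory.Arc_Walk"
begin

text \<open>
  The library locale \<open>digraph\<close> also requires finiteness, so a simple digraph is
  described by its two other parts; both include well-formedness.
\<close>

definition simple_digraph :: "('a, 'b) pre_digraph \<Rightarrow> bool" where
  "simple_digraph G \<longleftrightarrow> loopfree_digraph G \<and> nomulti_digraph G"

definition acyclic_digraph :: "('a, 'b) pre_digraph \<Rightarrow> bool" where
  "acyclic_digraph G \<longleftrightarrow> (\<nexists>p. pre_digraph.cycle G p)"

definition mono_out_arcs :: "('a, 'b) pre_digraph \<Rightarrow> ('a \<Rightarrow> nat) \<Rightarrow> 'a \<Rightarrow> 'b set" where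
  "mono_out_arcs G \<phi> v = {e \<in> out_arcs G v. \<phi> (head G e) = \<phi> v}"

definition nonmono_out_arcs :: "('a, 'b) pre_digraph \<Rightarrow> ('a \<Rightarrow> nat) \<Rightarrow> 'a \<Rightarrow> 'b set" where
  "nonmono_out_arcs G \<phi> v = {e \<in> out_arcs G v. \<phi> (head G e) \<noteq> \<phi> v}"

text \<open>
  Out-degrees may be infinite, so arc sets are compared by \<open>\<lesssim>\<close> and \<open>\<prec>\<close>, the
  order of cardinals; \<open>card\<close> would send all infinite sets to 0.
\<close>

definition majority_coloring :: "('a, 'b) pre_digraph \<Rightarrow> ('a \<Rightarrow> nat) \<Rightarrow> bool" where
  "majority_coloring G \<phi> \<longleftrightarrow>
    (\<forall>v \<in> verts G. mono_out_arcs G \<phi> v \<lesssim> nonmono_out_arcs G \<phi> v)"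

definition majority_colorable :: "nat \<Rightarrow> ('a, 'b) pre_digraph \<Rightarrow> bool" where
  "majority_colorable k G \<longleftrightarrow>
    (\<exists>\<phi>. majority_coloring G \<phi> \<and> finite (\<phi> ` verts G) \<and> card (\<phi> ` verts G) \<le> k)"

end

theory Submission
  imports Defs "HOL-Library.Extended_Real"
begin

text \<open>
  Read the colour of a vertex as a truth value, true meaning the colour of a fixed sink \<open>Ref\<close>.
  A vertex of out-degree 1 is a negation, and a vertex with out-neighbours \<open>a\<close>, \<open>b\<close>, \<open>Ref\<close> must
  be the NOR of \<open>a\<close> and \<open>b\<close>. If \<open>v\<close> has infinitely many out-neighbours whose truth values form an
  increasing sequence, then \<open>v\<close> is the negation of their limit. Hence an infinite NOR of vertices
  \<open>a\<^sub>0, a\<^sub>1, \<dots>\<close> can be enforced by pointing at all finite disjunctions \<open>a\<^sub>0 \<or> \<dots> \<or> a\<^sub>k\<close>. This allows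
  Yablo's paradox to be built: a sequence of sentences, each saying that all later ones
  are false, has no consistent assignment of truth values although no sentence refers to itself.
\<close>

text \<open>Any two cardinals are comparable, so a failed \<open>\<lesssim>\<close> gives a strict
  inequality the other way.\<close>

lemma not_lepoll_imp_lesspoll:
  assumes "\<not> A \<lesssim> B"
  shows "B \<prec> A"
proof -
  have "A \<lesssim> B \<or> B \<lesssim> A"
    using ordLeq_total[OF card_of_Well_order card_of_Well_order, of A B]
    by (simp add: lepoll_def flip: card_of_ordLeq)
  then show ?thesis
    using assms eqpoll_imp_lepoll eqpoll_sym unfolding lesspoll_def by blast
qed

lemma eq_if_card_image_le_2:
  assumes "finite (c ` A)" "card (c ` A) \<le> 2" "x \<in> A" "y \<in> A" "z \<in> A"
    and "c x \<noteq> c z" "c y \<noteq> c z"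
  shows "c x = c y"
proof (rule ccontr)
  assume "c x \<noteq> c y"
  then have "card {c x, c y, c z} = 3"
    using assms by simp
  moreover have "card {c x, c y, c z} \<le> card (c ` A)"
    using assms by (intro card_mono) auto
  ultimately show False
    using assms(2) by simp
qed

text \<open>Vertices are coded by numbers because the theorem asks for vertices of type
  \<open>nat\<close>. Arcs are pairs of endpoints, which excludes parallel arcs.\<close>

definition nat_digraph :: "('v::countable \<Rightarrow> 'v set) \<Rightarrow> (nat, nat \<times> nat) pre_digraph" where
  "nat_digraph N = \<lparr>verts = range (to_nat :: 'v \<Rightarrow> nat), arcs = {(to_nat v, to_nat w) | v w. w \<in> N v},
    tail = fst, head = snd\<rparr>"

lemma simple_nat_digraph:
  assumes "\<And>v. v \<notin> N v"
  shows "simple_digraph (nat_digraph N)"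
  unfolding simple_digraph_def nat_digraph_def
  by (intro conjI; unfold_locales) (use assms in \<open>auto simp: arc_to_ends_def\<close>)

text \<open>\<open>rank\<close> grows along every nonempty walk, so no such walk can return to its
  start.\<close>

lemma acyclic_nat_digraph:
  fixes rank :: "'v::countable \<Rightarrow> 'r::order"
  assumes rank: "\<And>v w. w \<in> N v \<Longrightarrow> rank v < rank w"
  shows "acyclic_digraph (nat_digraph N)"
proof -
  let ?G = "nat_digraph N"
  have increasing: "rank (from_nat u) < rank (from_nat w)"
    if "set p \<subseteq> arcs ?G" "pre_digraph.cas ?G u p w" "p \<noteq> []" for u w p
    using that
  proof (induction p arbitrary: u)
    case (Cons e p)
    have step: "rank (from_nat u) < rank (from_nat (snd e))"
      using Cons.prems rank by (auto simp: nat_digraph_def pre_digraph.cas.simps)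
    have rest: "pre_digraph.cas ?G (snd e) p w"
      using Cons.prems by (simp add: nat_digraph_def pre_digraph.cas.simps)
    show ?case
    proof (cases "p = []")
      case True
      then show ?thesis
        using step rest by (simp add: pre_digraph.cas.simps)
    next
      case False
      then show ?thesis
        using step Cons.IH[OF _ rest] Cons.prems by force
    qed
  qed simp
  show ?thesis
    unfolding acyclic_digraph_def pre_digraph.cycle_def pre_digraph.awalk_def
    using increasing by blast
qed

lemma majority_coloring_nat_digraph:
  fixes N :: "'v::countable \<Rightarrow> 'v set"
  shows "majority_coloring (nat_digraph N) \<phi> \<longleftrightarrow>
    (\<forall>v. {w \<in> N v. \<phi> (to_nat w) = \<phi> (to_nat v)} \<lesssim> {w \<in> N v. \<phi> (to_nat w) \<noteq> \<phi> (to_nat v)})"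
proof -
  have arcs: "mono_out_arcs (nat_digraph N) \<phi> (to_nat v)
      = (\<lambda>w. (to_nat v, to_nat w)) ` {w \<in> N v. \<phi> (to_nat w) = \<phi> (to_nat v)}"
    "nonmono_out_arcs (nat_digraph N) \<phi> (to_nat v)
      = (\<lambda>w. (to_nat v, to_nat w)) ` {w \<in> N v. \<phi> (to_nat w) \<noteq> \<phi> (to_nat v)}" for v
    by (auto simp: mono_out_arcs_def nonmono_out_arcs_def nat_digraph_def out_arcs_def)
  have inj: "inj_on (\<lambda>w. (to_nat v, to_nat w)) A" for v :: 'v and A
    by (simp add: inj_on_def)
  have "verts (nat_digraph N) = range (to_nat :: 'v \<Rightarrow> nat)"
    by (simp add: nat_digraph_def)
  then show ?thesis
    by (simp add: majority_coloring_def arcs inj)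
qed

text \<open>
  \<open>Disj i k\<close> is the disjunction of \<open>Yablo (i + 1), \<dots>, Yablo (i + k + 1)\<close> and \<open>Nor i k\<close> its negation.
\<close>

datatype vertex = Ref | Yablo nat | Disj nat nat | Nor nat nat

instance vertex :: countable
  by countable_datatype

fun out_nbrs :: "vertex \<Rightarrow> vertex set" where
  "out_nbrs Ref = {}"
| "out_nbrs (Yablo i) = range (Disj i)"
| "out_nbrs (Disj i k) = {Nor i k}"
| "out_nbrs (Nor i 0) = {Yablo (i + 1)}"
| "out_nbrs (Nor i (Suc k)) = {Disj i k, Yablo (i + k + 2), Ref}"

text \<open>
  \<open>Yablo i\<close> reaches \<open>Disj i k\<close> for all \<open>k\<close> and these reach their predecessors, so the vertices
  \<open>Disj i k\<close>, \<open>Nor i k\<close> descend from below \<open>i + 1\<close> towards \<open>i\<close> as \<open>k\<close> grows.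
\<close>

fun rank :: "vertex \<Rightarrow> ereal" where
  "rank Ref = \<infinity>"
| "rank (Yablo i) = ereal (real i)"
| "rank (Disj i k) = ereal (real i + 1 / (2 * real k + 3))"
| "rank (Nor i k) = ereal (real i + 1 / (2 * real k + 2))"

lemma rank_less_if_out_nbr:
  assumes "w \<in> out_nbrs v"
  shows "rank v < rank w"
  using assms by (cases v rule: out_nbrs.cases) (auto simp: field_simps add_pos_nonneg)

text \<open>If \<open>y i\<close> held, everything after \<open>i\<close> would be false; then
  everything after \<open>i + 1\<close> is false too, which makes \<open>y (i + 1)\<close> true. So
  every \<open>y i\<close> is false, which in turn makes \<open>y 0\<close> true.\<close>

lemma Yablo_paradox:
  assumes "\<And>i::nat. y i \<longleftrightarrow> (\<forall>j>i. \<not> y j)"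
  shows False
  using assms by (meson lessI less_trans)

lemma not_majority_coloring_two_colors:
  fixes c :: "vertex \<Rightarrow> nat"
  assumes majority: "\<And>v. {w \<in> out_nbrs v. c w = c v} \<lesssim> {w \<in> out_nbrs v. c w \<noteq> c v}"
    and two: "\<And>x y z. c x \<noteq> c z \<Longrightarrow> c y \<noteq> c z \<Longrightarrow> c x = c y"
  shows False
proof -
  define tr where "tr v \<longleftrightarrow> c v = c Ref" for v
  have eq_iff: "c v = c w \<longleftrightarrow> (tr v \<longleftrightarrow> tr w)" for v w
    unfolding tr_def using two by metis
  have tr_Ref: "tr Ref"
    by (simp add: tr_def)
  note majority = majority[unfolded eq_iff]
  have neg: "tr v \<longleftrightarrow> \<not> tr a" if "out_nbrs v = {a}" for v a
  proof (rule ccontr)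
    assume "\<not> ?thesis"
    then have "{w \<in> out_nbrs v. tr w \<noteq> tr v} = {}" "{w \<in> out_nbrs v. tr w = tr v} = {a}"
      using that by auto
    then show False
      using majority[of v] by (metis insert_not_empty lepoll_empty_iff_empty)
  qed
  have nor: "tr v \<longleftrightarrow> \<not> tr a \<and> \<not> tr b"
    if N: "out_nbrs v = {a, b, Ref}" and distinct: "distinct [a, b, Ref]" for v a b
  proof -
    let ?S = "{w \<in> out_nbrs v. tr w = tr v}" and ?D = "{w \<in> out_nbrs v. tr w \<noteq> tr v}"
    have fin: "finite ?S" "finite ?D"
      using N by auto
    then have "card ?S \<le> card ?D"
      using majority[of v] lepoll_iff_card_le by blast
    moreover have "card ?S + card ?D = card (?S \<union> ?D)"
      using fin by (intro card_Un_disjoint[symmetric]) auto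
    moreover have "?S \<union> ?D = {a, b, Ref}"
      using N by auto
    ultimately have "card ?S < 2"
      using distinct by simp
    \<comment> \<open>At most one of the three out-neighbours agrees with \<open>v\<close>. If
      \<open>v\<close> is true, \<open>Ref\<close> is that one and \<open>a\<close>,
      \<open>b\<close> are false; if \<open>v\<close> is false, \<open>a\<close> and
      \<open>b\<close> cannot both be false.\<close>
    then have one: "x = y" if "x \<in> ?S" "y \<in> ?S" for x y
      using card_le_Suc0_iff_eq[OF fin(1)] that by simp
    show ?thesis
      using one[of a b] one[of a Ref] one[of b Ref] N distinct tr_Ref by auto
  qed
  have disj: "tr (Disj i k) \<longleftrightarrow> (\<exists>j\<le>k. tr (Yablo (i + j + 1)))" for i k
  proof (induction k)
    case 0
    show ?case
      using neg[of "Disj i 0" "Nor i 0"] neg[of "Nor i 0" "Yablo (i + 1)"] by simp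
  next
    case (Suc k)
    have "tr (Disj i (Suc k)) \<longleftrightarrow> tr (Disj i k) \<or> tr (Yablo (i + k + 2))"
      using neg[of "Disj i (Suc k)" "Nor i (Suc k)"]
        nor[of "Nor i (Suc k)" "Disj i k" "Yablo (i + k + 2)"] by simp
    then show ?case
      using Suc.IH by (auto simp: le_Suc_eq)
  qed
  have "tr (Yablo i) \<longleftrightarrow> (\<forall>k. \<not> tr (Disj i k))" for i
  proof
    assume true: "tr (Yablo i)"
    show "\<forall>k. \<not> tr (Disj i k)"
    proof (rule ccontr)
      assume "\<not> ?thesis"
      then obtain k where k: "tr (Disj i k)"
        by blast
      \<comment> \<open>Disjunctions stay true once true, so a true \<open>Yablo i\<close> would
        disagree with only finitely many of its infinitely many out-neighbours.\<close>
      have mono: "tr (Disj i l)" if "k \<le> l" for l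
        using k that unfolding disj by (meson order_trans)
      have "{w \<in> out_nbrs (Yablo i). tr w \<noteq> tr (Yablo i)} \<subseteq> Disj i ` {..<k}"
        using mono true by (force simp flip: not_le)
      then have "finite {w \<in> out_nbrs (Yablo i). tr w \<noteq> tr (Yablo i)}"
        by (rule finite_subset) simp
      then have "finite {w \<in> out_nbrs (Yablo i). tr w = tr (Yablo i)}"
        using majority[of "Yablo i"] lepoll_trans
        by (metis (no_types, lifting) finite_lepoll_infinite infinite_le_lepoll)
      moreover have "Disj i ` {k..} \<subseteq> {w \<in> out_nbrs (Yablo i). tr w = tr (Yablo i)}"
        using mono true by auto
      ultimately have "finite (Disj i ` {k..})"
        by (rule rev_finite_subset)
      then show False
        by (auto simp: finite_image_iff inj_on_def infinite_Ici)
    qed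
  next
    assume false: "\<forall>k. \<not> tr (Disj i k)"
    show "tr (Yablo i)"
    proof (rule ccontr)
      assume "\<not> tr (Yablo i)"
      then have "{w \<in> out_nbrs (Yablo i). tr w \<noteq> tr (Yablo i)} = {}"
        "{w \<in> out_nbrs (Yablo i). tr w = tr (Yablo i)} \<noteq> {}"
        using false by auto
      then show False
        using majority[of "Yablo i"] by (metis lepoll_empty_iff_empty)
    qed
  qed
  \<comment> \<open>Every \<open>j > i\<close> has the form \<open>i + l + 1\<close>, hence occurs
    in \<open>Disj i l\<close>.\<close>
  moreover have "(\<forall>k. \<not> tr (Disj i k)) \<longleftrightarrow> (\<forall>j>i. \<not> tr (Yablo j))" for i
    unfolding disj by (metis less_iff_Suc_add add_Suc_right Suc_eq_plus1 order_refl)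
  ultimately show False
    using Yablo_paradox[of "\<lambda>i. tr (Yablo i)"] by blast
qed

theorem theorem2p3:
  shows "\<exists>G :: (nat, nat \<times> nat) pre_digraph.
    simple_digraph G \<and> countable (verts G) \<and> acyclic_digraph G \<and>
    \<not> majority_colorable 2 G \<and>
    (\<forall>\<phi> \<in> verts G \<rightarrow> {1, 2}. \<exists>v \<in> verts G. nonmono_out_arcs G \<phi> v \<prec> mono_out_arcs G \<phi> v)"
proof (intro exI conjI)
  let ?G = "nat_digraph out_nbrs"
  \<comment> \<open>Both remaining claims, on 2-colorability and on maps into \<open>{1, 2}\<close>,
    reduce to this.\<close>
  have not_majority: "\<not> majority_coloring ?G \<phi>"
    if "finite (\<phi> ` verts ?G)" "card (\<phi> ` verts ?G) \<le> 2" for \<phi>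
  proof
    assume "majority_coloring ?G \<phi>"
    moreover have "\<phi> (to_nat x) = \<phi> (to_nat y)"
      if "\<phi> (to_nat x) \<noteq> \<phi> (to_nat z)" "\<phi> (to_nat y) \<noteq> \<phi> (to_nat z)" for x y z :: vertex
      using that by (intro eq_if_card_image_le_2[OF \<open>finite _\<close> \<open>card _ \<le> 2\<close>, of _ _ "to_nat z"])
        (auto simp: nat_digraph_def)
    ultimately show False
      using not_majority_coloring_two_colors[of "\<lambda>v. \<phi> (to_nat v)"]
      unfolding majority_coloring_nat_digraph by blast
  qed
  show "simple_digraph ?G"
    using rank_less_if_out_nbr by (intro simple_nat_digraph) blast
  show "countable (verts ?G)"
    by (rule countableI_type)
  show "acyclic_digraph ?G"
    using rank_less_if_out_nbr by (rule acyclic_nat_digraph)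
  show "\<not> majority_colorable 2 ?G"
    using not_majority unfolding majority_colorable_def by blast
  show "\<forall>\<phi> \<in> verts ?G \<rightarrow> {1, 2}. \<exists>v \<in> verts ?G. nonmono_out_arcs ?G \<phi> v \<prec> mono_out_arcs ?G \<phi> v"
  proof
    fix \<phi> :: "nat \<Rightarrow> nat"
    assume "\<phi> \<in> verts ?G \<rightarrow> {1, 2}"
    then have sub: "\<phi> ` verts ?G \<subseteq> {1, 2}"
      by auto
    then have "finite (\<phi> ` verts ?G)" "card (\<phi> ` verts ?G) \<le> 2"
      using card_mono[OF _ sub] finite_subset[OF sub] by simp_all
    then have "\<not> majority_coloring ?G \<phi>"
      by (rule not_majority)
    then show "\<exists>v \<in> verts ?G. nonmono_out_arcs ?G \<phi> v \<prec> mono_out_arcs ?G \<phi> v"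
      unfolding majority_coloring_def using not_lepoll_imp_lesspoll by blast
  qed
qed

end
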